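(* Let $r\ge2$ and $m,n\ge0$ be integers with $r>m+1$. Then \[ \sum_{p = 0}^n \binom{m+p}m T(r - m - 1,\,n - p + 1,\,m + p + 1) = \sum_{i = n}^{m + n} \binom in E(i + 1,\,r - i + n) - \sum_{i = n + 1}^{m + n} \binom in\zeta (i + 1)\zeta (r - i + n). \]
   Context: $H_{\nu,k}=\sum_{j=1}^\nu j^{-k}$; $E(m,n)=\sum_{\nu=1}^\infty H_{\nu,m}/\nu^n$ is the linear Euler sum; $T(r,s,t)=\sum_{\mu=1}^\infty\sum_{\nu=1}^\infty \frac{1}{\mu^r\nu^s(\mu+\nu)^t}$ is the Tornheim double series; $\zeta$ is the Riemann zeta function. Empty sums are zero. *)

theory Defs
  imports Complex_Main
begin

text \<open>
  All series run over the positive integers, so the summation index is shifted by one.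
  Exponents are natural numbers. A divergent \<^const>\<open>suminf\<close> has no meaningful value, so the
  values below are to be read under the stated convergence conditions.
\<close>

definition gen_harmonic :: "nat \<Rightarrow> nat \<Rightarrow> real" where
  "gen_harmonic \<nu> k = (\<Sum>j = 1..\<nu>. 1 / real j ^ k)"

text \<open>The Riemann zeta function at an integer argument \<open>k \<ge> 2\<close>, where it is given by its
  Dirichlet series.\<close>

definition zeta_nat :: "nat \<Rightarrow> real" where
  "zeta_nat k = (\<Sum>\<nu>. 1 / real (Suc \<nu>) ^ k)"

text \<open>Linear Euler sum; convergent for \<open>m \<ge> 1\<close>, \<open>n \<ge> 2\<close>.\<close>

definition euler_sum :: "nat \<Rightarrow> nat \<Rightarrow> real" where
  "euler_sum m n = (\<Sum>\<nu>. gen_harmonic (Suc \<nu>) m / real (Suc \<nu>) ^ n)"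

text \<open>Tornheim double series; the outer index is \<open>\<mu>\<close>, the inner one \<open>\<nu>\<close>. For exponents
  \<open>r, s, t \<ge> 1\<close> it converges, and since the terms are positive the order of summation is
  immaterial.\<close>

definition tornheim :: "nat \<Rightarrow> nat \<Rightarrow> nat \<Rightarrow> real" where
  "tornheim r s t =
     (\<Sum>\<mu>. \<Sum>\<nu>. 1 / (real (Suc \<mu>) ^ r * real (Suc \<nu>) ^ s * real (Suc \<mu> + Suc \<nu>) ^ t))"

end

theory Submission
  imports Defs "HOL-Analysis.Summation_Tests"
begin

text \<open>
  Decomposing \<open>1 / (\<mu>\<^sup>m\<^sup>+\<^sup>1 \<nu>\<^sup>n\<^sup>+\<^sup>1)\<close> into partial fractions with respect to
  \<open>\<mu> + \<nu>\<close> turns the weighted sum of Tornheim summands into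
  \<open>1 / (\<mu>\<^sup>r \<nu>\<^sup>n\<^sup>+\<^sup>1)\<close> minus multiples of \<open>1 / (\<mu>\<^sup>r\<^sup>-\<^sup>q (\<mu> + \<nu>)\<^sup>n\<^sup>+\<^sup>q\<^sup>+\<^sup>1)\<close>
  for \<open>q \<le> m\<close>. Summing over \<open>\<nu>\<close>, the first term and the one with \<open>q = 0\<close> telescope to a
  generalized harmonic number, even for \<open>n = 0\<close>, where neither converges on its own;
  for \<open>q > 0\<close> the sum is a tail of \<open>\<zeta>(n + q + 1)\<close>. Summing over \<open>\<mu>\<close> gives Euler sums
  and products of zeta values.
\<close>

section \<open>Partial fractions as an identity in a commutative ring\<close>

text \<open>With \<open>u = 1 / (x + y)\<close> and \<open>w = 1 / y\<close> this is the part at the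
  pole \<open>y = 0\<close> in the decomposition of \<open>1 / (x ^ (m + 1) * y ^ (n + 1))\<close>
  for fixed \<open>x + y\<close>. Working with reciprocals as ring elements avoids division.\<close>

definition pfd_part :: "nat \<Rightarrow> nat \<Rightarrow> 'a \<Rightarrow> 'a \<Rightarrow> 'a::comm_ring_1" where
  "pfd_part m n u w = (\<Sum>p\<le>n. of_nat ((m + p) choose m) * (w ^ (n - p + 1) * u ^ (m + p + 1)))"

lemma pfd_part_0_right: "pfd_part m 0 u w = w * u ^ (m + 1)"
  by (simp add: pfd_part_def)

lemma pfd_part_0_Suc: "pfd_part 0 (Suc n) u w = w * pfd_part 0 n u w + w * u ^ (n + 2)"
  by (simp add: pfd_part_def sum_distrib_left Suc_diff_le algebra_simps)

text \<open>Pascal's rule: lowering \<open>m\<close> and lowering \<open>n\<close> contribute the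
  two binomials that add up to \<open>(Suc m + p) choose Suc m\<close>.\<close>

lemma pfd_part_Suc_Suc:
  "pfd_part (Suc m) (Suc n) u w = u * (pfd_part m (Suc n) u w + pfd_part (Suc m) n u w)"
proof -
  let ?t = "\<lambda>p. w ^ (Suc n - p + 1) * u ^ (m + p + 2)"
  have "u * pfd_part (Suc m) n u w = (\<Sum>p\<le>n. of_nat ((m + Suc p) choose Suc m) * ?t (Suc p))"
    by (simp add: pfd_part_def sum_distrib_left algebra_simps)
  \<comment> \<open>After the shift the new term \<open>p = 0\<close> vanishes, because
    \<open>m choose Suc m = 0\<close>.\<close>
  also have "\<dots> = (\<Sum>p\<le>Suc n. of_nat ((m + p) choose Suc m) * ?t p)"
    by (subst sum.atMost_Suc_shift) (simp add: binomial_eq_0)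
  finally have *: "u * pfd_part (Suc m) n u w = \<dots>" .
  have "u * pfd_part m (Suc n) u w = (\<Sum>p\<le>Suc n. of_nat ((m + p) choose m) * ?t p)"
    unfolding pfd_part_def sum_distrib_left by (intro sum.cong) (auto simp: algebra_simps)
  with * have "u * (pfd_part m (Suc n) u w + pfd_part (Suc m) n u w) =
      (\<Sum>p\<le>Suc n. of_nat ((m + p) choose m) * ?t p + of_nat ((m + p) choose Suc m) * ?t p)"
    by (simp only: distrib_left sum.distrib)
  also have "\<dots> = pfd_part (Suc m) (Suc n) u w"
    unfolding pfd_part_def by (intro sum.cong) (auto simp: algebra_simps)
  finally show ?thesis ..
qed

text \<open>Multiplying the case \<open>n\<close> by \<open>w\<close> leaves
  \<open>v * w * u ^ (n + 1)\<close>, which the assumption splits into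
  \<open>u ^ (n + 2) * (v + w)\<close>, one new term for each pole part.\<close>

lemma partial_fractions_0:
  fixes u v w :: "'a::comm_ring_1"
  assumes "v * w = u * (v + w)"
  shows "v * w ^ (n + 1) = pfd_part 0 n u w + pfd_part n 0 u v"
proof (induction n)
  case 0
  show ?case using assms by (simp add: pfd_part_0_right algebra_simps)
next
  case (Suc n)
  have "v * w ^ (Suc n + 1) = w * (v * w ^ (n + 1))" by simp
  also have "\<dots> = w * pfd_part 0 n u w + (v * w) * u ^ (n + 1)"
    by (subst Suc.IH) (simp add: pfd_part_0_right algebra_simps)
  also have "\<dots> = pfd_part 0 (Suc n) u w + pfd_part (Suc n) 0 u v"
    by (simp only: pfd_part_0_Suc pfd_part_0_right assms) (simp add: algebra_simps)
  finally show ?case .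
qed

text \<open>Here \<open>u\<close>, \<open>v\<close>, \<open>w\<close> stand for the reciprocals of \<open>x + y\<close>, \<open>x\<close>, \<open>y\<close>.\<close>

lemma partial_fractions:
  fixes u v w :: "'a::comm_ring_1"
  assumes "v * w = u * (v + w)"
  shows "v ^ (m + 1) * w ^ (n + 1) = pfd_part m n u w + pfd_part n m u v"
proof (induction "m + n" arbitrary: m n)
  case 0
  then show ?case using partial_fractions_0[OF assms, of 0] by simp
next
  case (Suc k)
  show ?case
  proof (cases m)
    case 0
    then show ?thesis using partial_fractions_0[OF assms, of n] by simp
  next
    case m: (Suc m')
    show ?thesis
    proof (cases n)
      case 0
      \<comment> \<open>The assumption is symmetric, so this is the previous case with
        \<open>v\<close> and \<open>w\<close> exchanged.\<close>
      have "w * v = u * (w + v)" using assms by (simp add: algebra_simps)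
      from partial_fractions_0[OF this, of m] 0 show ?thesis by (simp add: algebra_simps)
    next
      case n: (Suc n')
      \<comment> \<open>Replacing one factor \<open>v * w\<close> by \<open>u * (v + w)\<close>
        lowers one exponent at a time, matching the recursion of \<open>pfd_part\<close>.\<close>
      have "v ^ (m + 1) * w ^ (n + 1) = (v * w) * (v ^ (m' + 1) * w ^ (n' + 1))"
        by (simp add: m n algebra_simps)
      also have "\<dots> = u * (v ^ (m + 1) * w ^ (n' + 1) + v ^ (m' + 1) * w ^ (n + 1))"
        unfolding assms by (simp add: m n algebra_simps)
      also have "\<dots> = u * (pfd_part m n' u w + pfd_part n' m u v
                          + (pfd_part m' n u w + pfd_part n m' u v))"
        using Suc.hyps(1)[of m n'] Suc.hyps(1)[of m' n] Suc.hyps(2) by (simp add: m n)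
      also have "\<dots> = pfd_part m n u w + pfd_part n m u v"
        unfolding m n pfd_part_Suc_Suc by (simp add: algebra_simps)
      finally show ?thesis .
    qed
  qed
qed

section \<open>Harmonic numbers, zeta tails and Euler sums as convergent series\<close>

text \<open>Raising the shift by one adds a telescoping series with sum \<open>f d\<close>.
  Convergence of \<open>f\<close> to 0 suffices, so \<open>f\<close> may be the harmonic
  sequence.\<close>

lemma sums_diff_shift:
  fixes f :: "nat \<Rightarrow> 'a::real_normed_vector"
  assumes "f \<longlonglongrightarrow> 0"
  shows "(\<lambda>k. f k - f (k + d)) sums (\<Sum>j<d. f j)"
proof (induction d)
  case 0
  then show ?case by simp
next
  case (Suc d)
  have "(\<lambda>k. f (k + d) - f (Suc k + d)) sums (f (0 + d) - 0)"
    by (rule telescope_sums') (use LIMSEQ_ignore_initial_segment[OF assms] in simp)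
  from sums_add[OF Suc.IH this] show ?case by simp
qed

lemma gen_harmonic_Suc: "gen_harmonic (Suc \<mu>) k = gen_harmonic \<mu> k + 1 / real (Suc \<mu>) ^ k"
  by (simp add: gen_harmonic_def)

lemma gen_harmonic_nonneg: "gen_harmonic \<mu> k \<ge> 0"
  by (simp add: gen_harmonic_def sum_nonneg)

lemma gen_harmonic_antimono:
  assumes "k \<le> l"
  shows "gen_harmonic \<mu> l \<le> gen_harmonic \<mu> k"
  unfolding gen_harmonic_def
  by (intro sum_mono divide_left_mono power_increasing) (use assms in auto)

lemma gen_harmonic_sums:
  assumes "k \<ge> 1"
  shows "(\<lambda>\<nu>. 1 / real (Suc \<nu>) ^ k - 1 / real (\<mu> + Suc \<nu>) ^ k) sums gen_harmonic \<mu> k"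
proof -
  have "(\<lambda>\<nu>. (1 / real (Suc \<nu>)) ^ k) \<longlonglongrightarrow> 0 ^ k"
    by (intro tendsto_power LIMSEQ_Suc lim_1_over_n)
  then have "(\<lambda>\<nu>. 1 / real (Suc \<nu>) ^ k) \<longlonglongrightarrow> 0"
    using assms by (simp add: power_one_over power_0_left)
  from sums_diff_shift[OF this, of \<mu>] show ?thesis
    by (simp add: gen_harmonic_def sum.atLeast1_atMost_eq add_ac)
qed

lemma zeta_nat_sums:
  assumes "k \<ge> 2"
  shows "(\<lambda>\<nu>. 1 / real (Suc \<nu>) ^ k) sums zeta_nat k"
proof -
  have "summable (\<lambda>\<nu>. 1 / real (Suc \<nu>) ^ k)"
    using inverse_power_summable[OF assms, where 'a = real]
    by (subst summable_Suc_iff) (simp add: field_simps)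
  then show ?thesis unfolding zeta_nat_def by (rule summable_sums)
qed

lemma zeta_nat_tail_sums:
  assumes "k \<ge> 2"
  shows "(\<lambda>\<nu>. 1 / real (\<mu> + Suc \<nu>) ^ k) sums (zeta_nat k - gen_harmonic \<mu> k)"
  using sums_diff[OF zeta_nat_sums[OF assms] gen_harmonic_sums[of k \<mu>]] assms by simp

text \<open>Telescoping majorant: with \<open>g(\<nu>) = (H\<^sub>\<nu> + 1) / \<nu>\<close> one has
  \<open>H\<^sub>\<nu> / (\<nu> (\<nu> + 1)) \<le> g(\<nu>) - g(\<nu> + 1)\<close>.\<close>

lemma summable_gen_harmonic_1_over_square:
  "summable (\<lambda>\<nu>. gen_harmonic (Suc \<nu>) 1 / real (Suc \<nu>) ^ 2)"
proof -
  let ?g = "\<lambda>\<nu>. (gen_harmonic (Suc \<nu>) 1 + 1) / real (Suc \<nu>)"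
  define d where "d \<nu> = ?g \<nu> - ?g (Suc \<nu>)" for \<nu>
  have bound: "gen_harmonic (Suc \<nu>) 1 / real (Suc \<nu>) ^ 2 \<le> 2 * d \<nu>" for \<nu>
  proof -
    define x where "x = real (Suc \<nu>)"
    define H where "H = gen_harmonic (Suc \<nu>) 1"
    have x: "x \<ge> 1" and H: "H \<ge> 0" by (auto simp: x_def H_def gen_harmonic_nonneg)
    \<comment> \<open>The factor 2 comes from \<open>x + 1 \<le> 2 * x\<close>.\<close>
    have "H / x ^ 2 \<le> 2 * (H / (x * (x + 1)))"
    proof -
      have "x * (x + 1) \<le> 2 * x ^ 2" using x by (simp add: power2_eq_square algebra_simps)
      then have "H * 2 / (2 * x ^ 2) \<le> H * 2 / (x * (x + 1))"
        using x H by (intro divide_left_mono) auto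
      then show ?thesis by (simp add: mult.commute)
    qed
    also have "H / (x * (x + 1)) \<le> (H + 1) / x - (H + 1 / (x + 1) + 1) / (x + 1)"
    proof -
      \<comment> \<open>The summand 1 in \<open>?g\<close> contributes
        \<open>1 / (x * (x + 1))\<close>, which outweighs the loss \<open>1 / (x + 1) ^ 2\<close>
        caused by the growth of the harmonic number.\<close>
      have "(H + 1) / x - (H + 1 / (x + 1) + 1) / (x + 1) - H / (x * (x + 1))
            = 1 / (x * (x + 1) ^ 2)"
        using x by (simp add: divide_simps power2_eq_square) (simp add: algebra_simps)
      moreover have "\<dots> \<ge> 0" using x by simp
      ultimately show ?thesis by linarith
    qed
    also have "\<dots> = d \<nu>"
      by (simp add: d_def gen_harmonic_Suc x_def H_def add_ac)
    finally show ?thesis by (simp add: x_def H_def)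
  qed
  have d_nonneg: "d \<nu> \<ge> 0" for \<nu>
  proof -
    have "0 \<le> gen_harmonic (Suc \<nu>) 1 / real (Suc \<nu>) ^ 2"
      by (intro divide_nonneg_nonneg gen_harmonic_nonneg) simp
    then have "0 \<le> 2 * d \<nu>" using bound by (rule order_trans)
    then show ?thesis by linarith
  qed
  have "(\<Sum>\<nu><N. d \<nu>) \<le> ?g 0" for N
    using gen_harmonic_nonneg[of "Suc N" 1] unfolding d_def by (subst sum_lessThan_telescope') simp
  then have "summable d"
    by (intro summableI_nonneg_bounded[of _ "?g 0"] d_nonneg)
  then have "summable (\<lambda>\<nu>. 2 * d \<nu>)" by (rule summable_mult)
  then show ?thesis
    by (rule summable_comparison_test') (use bound gen_harmonic_nonneg in simp)
qed

lemma euler_sum_sums: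
  assumes "k \<ge> 1" "s \<ge> 2"
  shows "(\<lambda>\<nu>. gen_harmonic (Suc \<nu>) k / real (Suc \<nu>) ^ s) sums euler_sum k s"
proof -
  have "summable (\<lambda>\<nu>. gen_harmonic (Suc \<nu>) k / real (Suc \<nu>) ^ s)"
  proof (rule summable_comparison_test'[OF summable_gen_harmonic_1_over_square])
    fix \<nu> :: nat
    have "gen_harmonic (Suc \<nu>) k / real (Suc \<nu>) ^ s \<le> gen_harmonic (Suc \<nu>) 1 / real (Suc \<nu>) ^ 2"
      by (intro frac_le gen_harmonic_antimono power_increasing assms gen_harmonic_nonneg) auto
    then show "norm (gen_harmonic (Suc \<nu>) k / real (Suc \<nu>) ^ s)
        \<le> gen_harmonic (Suc \<nu>) 1 / real (Suc \<nu>) ^ 2"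
      by (simp add: gen_harmonic_nonneg)
  qed
  then show ?thesis unfolding euler_sum_def by (rule summable_sums)
qed

section \<open>Convergence of the Tornheim double series\<close>

definition tornheim_term :: "nat \<Rightarrow> nat \<Rightarrow> nat \<Rightarrow> nat \<Rightarrow> nat \<Rightarrow> real" where
  "tornheim_term r s t \<mu> \<nu> =
     1 / (real (Suc \<mu>) ^ r * real (Suc \<nu>) ^ s * real (Suc \<mu> + Suc \<nu>) ^ t)"

lemma tornheim_term_nonneg: "tornheim_term r s t \<mu> \<nu> \<ge> 0"
  by (simp add: tornheim_term_def)

lemma tornheim_term_antimono:
  assumes "r' \<le> r" "s' \<le> s" "t' \<le> t"
  shows "tornheim_term r s t \<mu> \<nu> \<le> tornheim_term r' s' t' \<mu> \<nu>"
  unfolding tornheim_term_def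
  by (intro divide_left_mono mult_mono power_increasing mult_pos_pos assms) auto

text \<open>For fixed \<open>\<mu>\<close> the summand is a multiple of
  \<open>1 / y - 1 / (x + y)\<close>. The inner sums are the summands of E(1,2), so one majorant
  serves both Euler and Tornheim series.\<close>

lemma tornheim_term_1_sums:
  "tornheim_term 1 1 1 \<mu> sums (gen_harmonic (Suc \<mu>) 1 / real (Suc \<mu>) ^ 2)"
proof -
  have "1 / (x * y * (x + y)) = (1 / y - 1 / (x + y)) / x ^ 2" if "x > 0" "y > 0" for x y :: real
    using that by (simp add: divide_simps power2_eq_square)
  from this[of "real (Suc \<mu>)" "real (Suc _)"]
  have "tornheim_term 1 1 1 \<mu>
      = (\<lambda>\<nu>. (1 / real (Suc \<nu>) ^ 1 - 1 / real (Suc \<mu> + Suc \<nu>) ^ 1) / real (Suc \<mu>) ^ 2)"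
    by (simp add: tornheim_term_def fun_eq_iff)
  then show ?thesis
    using sums_divide[OF gen_harmonic_sums[of 1 "Suc \<mu>"], of "real (Suc \<mu>) ^ 2"] by simp
qed

lemma
  assumes "r \<ge> 1" "s \<ge> 1" "t \<ge> 1"
  shows tornheim_inner_summable: "summable (tornheim_term r s t \<mu>)"
    and tornheim_sums: "(\<lambda>\<mu>. \<Sum>\<nu>. tornheim_term r s t \<mu> \<nu>) sums tornheim r s t"
proof -
  have le: "tornheim_term r s t \<mu> \<nu> \<le> tornheim_term 1 1 1 \<mu> \<nu>" for \<mu> \<nu>
    by (intro tornheim_term_antimono assms)
  have inner: "summable (tornheim_term r s t \<mu>)" for \<mu>
    by (rule summable_comparison_test'[OF sums_summable[OF tornheim_term_1_sums[of \<mu>]]])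
       (use le[of \<mu>] tornheim_term_nonneg in simp)
  then show "summable (tornheim_term r s t \<mu>)" .
  have "summable (\<lambda>\<mu>. \<Sum>\<nu>. tornheim_term r s t \<mu> \<nu>)"
  proof (rule summable_comparison_test'[OF summable_gen_harmonic_1_over_square])
    fix \<mu>
    have "(\<Sum>\<nu>. tornheim_term r s t \<mu> \<nu>) \<le> (\<Sum>\<nu>. tornheim_term 1 1 1 \<mu> \<nu>)"
      by (intro suminf_le le inner sums_summable[OF tornheim_term_1_sums])
    with sums_unique[OF tornheim_term_1_sums[of \<mu>]] suminf_nonneg[OF inner[of \<mu>] tornheim_term_nonneg]
    show "norm (\<Sum>\<nu>. tornheim_term r s t \<mu> \<nu>) \<le> gen_harmonic (Suc \<mu>) 1 / real (Suc \<mu>) ^ 2"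
      by simp
  qed
  then show "(\<lambda>\<mu>. \<Sum>\<nu>. tornheim_term r s t \<mu> \<nu>) sums tornheim r s t"
    unfolding tornheim_def tornheim_term_def by (rule summable_sums)
qed

section \<open>Summing the decomposition over both indices\<close>

text \<open>The decomposition is multiplied by \<open>v ^ (r - m - 1)\<close>. The term
  \<open>q = 0\<close> is grouped with \<open>v ^ r * w ^ (n + 1)\<close>, since for
  \<open>n = 0\<close> only their difference is summable over \<open>\<nu>\<close>.\<close>

lemma tornheim_term_partial_fractions:
  assumes "r > m + 1"
  shows "(\<Sum>p\<le>n. real ((m + p) choose m) * tornheim_term (r - m - 1) (n - p + 1) (m + p + 1) \<mu> \<nu>)
       = (1 / real (Suc \<nu>) ^ (n + 1) - 1 / real (Suc \<mu> + Suc \<nu>) ^ (n + 1)) / real (Suc \<mu>) ^ r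
         - (\<Sum>q=1..m. real ((n + q) choose n) * (1 / real (Suc \<mu> + Suc \<nu>) ^ (n + q + 1))
              / real (Suc \<mu>) ^ (r - q))"
proof -
  define v w u where "v = 1 / real (Suc \<mu>)" and "w = 1 / real (Suc \<nu>)"
    and "u = 1 / real (Suc \<mu> + Suc \<nu>)"
  note uvw = u_def v_def w_def
  have "1 / x * (1 / y) = 1 / (x + y) * (1 / x + 1 / y)" if "x > 0" "y > 0" for x y :: real
    using that by (simp add: divide_simps)
  from this[of "real (Suc \<mu>)" "real (Suc \<nu>)"] have "v * w = u * (v + w)" by (simp add: uvw)
  from partial_fractions[OF this, of m n]
  have pf: "pfd_part m n u w = v ^ (m + 1) * w ^ (n + 1) - pfd_part n m u v" by simp
  have "(\<Sum>p\<le>n. real ((m + p) choose m) * tornheim_term (r - m - 1) (n - p + 1) (m + p + 1) \<mu> \<nu>)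
      = v ^ (r - m - 1) * pfd_part m n u w"
    unfolding pfd_part_def sum_distrib_left
    by (intro sum.cong) (simp_all add: tornheim_term_def uvw power_one_over)
  also have "\<dots> = v ^ (r - m - 1 + (m + 1)) * w ^ (n + 1) - v ^ (r - m - 1) * pfd_part n m u v"
    unfolding pf power_add by (simp add: algebra_simps)
  also have "r - m - 1 + (m + 1) = r" using assms by simp
  also have "v ^ (r - m - 1) * pfd_part n m u v
      = (\<Sum>q\<le>m. real ((n + q) choose n) * u ^ (n + q + 1) * v ^ (r - q))"
    unfolding pfd_part_def sum_distrib_left
  proof (intro sum.cong refl)
    fix q assume "q \<in> {..m}"
    with assms have "r - q = r - m - 1 + (m - q + 1)" by simp
    then show "v ^ (r - m - 1) * (real ((n + q) choose n) * (v ^ (m - q + 1) * u ^ (n + q + 1)))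
        = real ((n + q) choose n) * u ^ (n + q + 1) * v ^ (r - q)"
      by (simp only: power_add mult_ac)
  qed
  also have "\<dots> = u ^ (n + 1) * v ^ r
      + (\<Sum>q=1..m. real ((n + q) choose n) * u ^ (n + q + 1) * v ^ (r - q))"
    by (simp add: atMost_atLeast0 sum.atLeast_Suc_atMost)
  also have "v ^ r * w ^ (n + 1) - \<dots> = (w ^ (n + 1) - u ^ (n + 1)) * v ^ r
      - (\<Sum>q=1..m. real ((n + q) choose n) * u ^ (n + q + 1) * v ^ (r - q))"
    by (simp add: algebra_simps)
  finally show ?thesis
    unfolding uvw power_one_over times_divide_eq_right mult_1_right .
qed

theorem theorem3p9:
  fixes r m n :: nat
  assumes "r \<ge> 2" and "r > m + 1"
  shows "(\<Sum>p = 0..n. real ((m + p) choose m) * tornheim (r - m - 1) (n - p + 1) (m + p + 1))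
       = (\<Sum>i = n..m + n. real (i choose n) * euler_sum (i + 1) (r + n - i))
       - (\<Sum>i = n + 1..m + n. real (i choose n) * zeta_nat (i + 1) * zeta_nat (r + n - i))"
proof -
  let ?T = "\<lambda>p. tornheim_term (r - m - 1) (n - p + 1) (m + p + 1)"
  let ?H = "\<lambda>k \<mu>. gen_harmonic (Suc \<mu>) k"
  let ?E = "\<lambda>q. real ((n + q) choose n) * euler_sum (n + q + 1) (r - q)"
  let ?Z = "\<lambda>q. real ((n + q) choose n) * zeta_nat (n + q + 1) * zeta_nat (r - q)"
  \<comment> \<open>\<open>L\<close> and \<open>R\<close> are the sums over \<open>\<nu>\<close> of
    the two sides of the decomposition, for fixed \<open>\<mu>\<close>.\<close>
  define L where "L \<mu> = (\<Sum>p\<le>n. real ((m + p) choose m) * (\<Sum>\<nu>. ?T p \<mu> \<nu>))" for \<mu>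
  define R where "R \<mu> = ?H (n + 1) \<mu> / real (Suc \<mu>) ^ r
    - (\<Sum>q=1..m. real ((n + q) choose n) * (zeta_nat (n + q + 1) - ?H (n + q + 1) \<mu>)
         / real (Suc \<mu>) ^ (r - q))" for \<mu>
  have "L \<mu> = R \<mu>" for \<mu>
  proof (rule sums_unique2)
    show "(\<lambda>\<nu>. \<Sum>p\<le>n. real ((m + p) choose m) * ?T p \<mu> \<nu>) sums L \<mu>"
      unfolding L_def using assms(2)
      by (intro sums_sum sums_mult summable_sums tornheim_inner_summable) auto
    show "(\<lambda>\<nu>. \<Sum>p\<le>n. real ((m + p) choose m) * ?T p \<mu> \<nu>) sums R \<mu>"
      unfolding R_def tornheim_term_partial_fractions[OF assms(2)]
      by (intro sums_diff sums_sum sums_mult sums_divide gen_harmonic_sums zeta_nat_tail_sums) auto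
  qed
  then have "L = R" ..
  moreover have "L sums (\<Sum>p\<le>n. real ((m + p) choose m)
      * tornheim (r - m - 1) (n - p + 1) (m + p + 1))"
    unfolding L_def using assms(2) by (intro sums_sum sums_mult tornheim_sums) auto
  moreover have "R sums (euler_sum (n + 1) r - (\<Sum>q=1..m. ?Z q - ?E q))"
  proof -
    have "(\<lambda>\<mu>. real ((n + q) choose n) * (zeta_nat (n + q + 1) - ?H (n + q + 1) \<mu>)
        / real (Suc \<mu>) ^ (r - q)) sums (?Z q - ?E q)" if "q \<in> {1..m}" for q
    proof -
      \<comment> \<open>This is where \<open>r > m + 1\<close> secures convergence: the zeta and
        Euler parts can be summed over \<open>\<mu>\<close> separately.\<close>
      have q: "r - q \<ge> 2" using that assms(2) by auto
      let ?c = "real ((n + q) choose n)"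
      have "(\<lambda>\<mu>. ?c * zeta_nat (n + q + 1) * (1 / real (Suc \<mu>) ^ (r - q))
          - ?c * (?H (n + q + 1) \<mu> / real (Suc \<mu>) ^ (r - q))) sums (?Z q - ?E q)"
        using q by (intro sums_diff sums_mult zeta_nat_sums euler_sum_sums) auto
      then show ?thesis by (simp add: diff_divide_distrib right_diff_distrib)
    qed
    then show ?thesis
      unfolding R_def using assms(1) by (intro sums_diff sums_sum euler_sum_sums) auto
  qed
  ultimately have "(\<Sum>p\<le>n. real ((m + p) choose m) * tornheim (r - m - 1) (n - p + 1) (m + p + 1))
      = euler_sum (n + 1) r - (\<Sum>q=1..m. ?Z q - ?E q)"
    by (simp only: sums_unique2)
  \<comment> \<open>The isolated \<open>euler_sum (n + 1) r\<close> is the term \<open>q = 0\<close>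
    of \<open>?E\<close>; the final sums arise from \<open>i = n + q\<close>.\<close>
  also have "\<dots> = (\<Sum>q=0..m. ?E q) - (\<Sum>q=1..m. ?Z q)"
    by (simp add: sum.atLeast_Suc_atMost sum_subtractf)
  also have "(\<Sum>q=0..m. ?E q) = (\<Sum>i=n..m + n. real (i choose n) * euler_sum (i + 1) (r + n - i))"
    using sum.shift_bounds_cl_nat_ivl
      [of "\<lambda>i. real (i choose n) * euler_sum (i + 1) (r + n - i)" 0 n m]
    by (simp add: add_ac)
  also have "(\<Sum>q=1..m. ?Z q)
      = (\<Sum>i=n + 1..m + n. real (i choose n) * zeta_nat (i + 1) * zeta_nat (r + n - i))"
    using sum.shift_bounds_cl_nat_ivl
      [of "\<lambda>i. real (i choose n) * zeta_nat (i + 1) * zeta_nat (r + n - i)" 1 n m]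
    by (simp add: add_ac)
  finally show ?thesis by (simp add: atMost_atLeast0)
qed

end
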